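(* Let $\alpha>0$ be real and let $x\in\mathbb{C}$, $x\neq 0$. Then $$J_{\alpha}(x)=\frac{1}{\Gamma(\alpha)}\left(\frac{x}{2}\right)^{\alpha}\int_0^1 J_0\left(x\sqrt{1-t}\right)t^{\alpha-1}\,dt$$ and $$J_{\alpha}(x)=\frac{1}{\pi x\,\Gamma(\alpha)}\left(\frac{x}{2}\right)^{\alpha}\int_0^{\pi/2}\int_0^{\pi}2\sin^{2\alpha-1}(\vartheta)\,\sin(\phi)\,\left[\frac{\partial}{\partial y}\bigl(y\sin(y\sin\phi)\bigr)\right]_{y=x\cos\vartheta}\,d\phi\,d\vartheta .$$
   Context: For real $\alpha\ge 0$ the Bessel function of the first kind is defined by $$J_{\alpha}(x)=\sum_{m=0}^{\infty}\frac{(-1)^m}{m!\,\Gamma(m+\alpha+1)}\left(\frac{x}{2}\right)^{2m+\alpha},$$ where $(x/2)^{2m+\alpha}=(x/2)^{2m}(x/2)^{\alpha}$ and $(x/2)^{\alpha}$ denotes the principal branch of the power (the same value being used on both sides of each identity). For $\alpha=0$, $(x/2)^0=1$, so $J_0(x)=\sum_{m\ge0}\frac{(-1)^m}{(m!)^2}(x/2)^{2m}$. Explicitly, $\frac{\partial}{\partial y}\bigl(y\sin(y\sin\phi)\bigr)=\sin(y\sin\phi)+y\sin\phi\cos(y\sin\phi)$. *)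

theory Defs
  imports "HOL-Analysis.Analysis"
begin

text \<open>
  The library's complex \<open>powr\<close> is the principal branch, but it has \<open>0 powr 0 = 0\<close>. The usual
  convention \<open>z\<^sup>0 = 1\<close> for all \<open>z\<close> is needed here so that \<open>J\<^sub>0(0) = 1\<close>.
\<close>

definition principal_pow :: "complex \<Rightarrow> real \<Rightarrow> complex" where
  "principal_pow z \<alpha> = (if \<alpha> = 0 then 1 else z powr complex_of_real \<alpha>)"

text \<open>The Bessel function of the first kind, intended for orders \<open>\<alpha> \<ge> 0\<close>.\<close>

definition Bessel_J :: "real \<Rightarrow> complex \<Rightarrow> complex" where
  "Bessel_J \<alpha> x =
     (\<Sum>m. (-1) ^ m / (fact m * complex_of_real (Gamma (real m + \<alpha> + 1)))
           * ((x / 2) ^ (2 * m) * principal_pow (x / 2) \<alpha>))"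

end

(* Integrating the power series of J_0 term by term against a weight of the form w(t) h(t)^m reduces
   each identity to a moment computation. In the first identity the moments are the Beta integrals
   B(alpha, m + 1). In the second, the moments of sin^2 over [0, pi] are Wallis integrals, which turn
   the inner integral into 2 pi sin(theta)^(2 alpha - 1) y J_0(y) with y = x cos(theta); the
   substitution t = sin(theta)^2 then leads back to the first identity. *)
theory Submission
  imports Defs
begin

section \<open>Termwise integration of weighted power series\<close>

text \<open>On \<open>A\<close> the m-th term is bounded by \<open>norm (c m)\<close> times
  \<open>\<bar>w t\<bar>\<close>, and the integrals of these bounds form a convergent series, so sum
  and integral may be exchanged. It is applied with h = 1 - t and w a power of t, and with h and w
  both equal to the squared sine.\<close>

lemma
  fixes c :: "nat \<Rightarrow> complex" and h w :: "'a \<Rightarrow> real"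
  assumes A [measurable]: "A \<in> sets M" and h [measurable]: "h \<in> borel_measurable M"
    and h_le: "\<And>t. t \<in> A \<Longrightarrow> \<bar>h t\<bar> \<le> 1"
    and w: "set_integrable M A w" and c: "summable (\<lambda>m. norm (c m))"
  shows set_integrable_power_series_weight:
      "set_integrable M A (\<lambda>t. (\<Sum>m. c m * of_real (h t ^ m)) * of_real (w t))"
    and set_integral_power_series_weight_sums:
      "(\<lambda>m. c m * of_real (LINT t:A|M. h t ^ m * w t)) sums
         (LINT t:A|M. (\<Sum>m. c m * of_real (h t ^ m)) * of_real (w t))"
proof -
  \<comment> \<open>The indicator is part of \<open>F\<close>, so that theorems on series of
    integrals over the whole space apply.\<close>
  define F where "F m t = indicator A t *\<^sub>R (c m * of_real (h t ^ m * w t))" for m t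
  have w' [measurable]: "(\<lambda>t. indicator A t * w t) \<in> borel_measurable M"
    using w unfolding set_integrable_def by auto
  have wn: "integrable M (\<lambda>t. \<bar>indicator A t * w t\<bar>)"
    using w unfolding set_integrable_def by auto
  have pow_le: "\<bar>h t ^ m\<bar> \<le> 1" if "t \<in> A" for t m
    using h_le[OF that] by (simp add: power_abs power_le_one)
  have moment: "integrable M (\<lambda>t. indicator A t * (h t ^ m * w t))" for m
  proof (rule Bochner_Integration.integrable_bound[OF wn])
    have "(\<lambda>t. h t ^ m * (indicator A t * w t)) \<in> borel_measurable M" by measurable
    then show "(\<lambda>t. indicator A t * (h t ^ m * w t)) \<in> borel_measurable M"
      by (simp add: mult_ac)
    show "AE t in M. norm (indicator A t * (h t ^ m * w t)) \<le> norm \<bar>indicator A t * w t\<bar>"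
      using pow_le by (auto simp: abs_mult mult_left_le_one_le split: split_indicator)
  qed
  have F_eq: "F m t = c m * of_real (indicator A t * (h t ^ m * w t))" for m t
    by (simp add: F_def scaleR_conv_of_real)
  have F_int: "integrable M (F m)" for m
    unfolding F_eq by (intro integrable_mult_right integrable_of_real moment)
  have F_le: "norm (F m t) \<le> norm (c m) * \<bar>indicator A t * w t\<bar>" for m t
    using pow_le[of t m]
    by (auto simp: F_def norm_mult norm_power abs_mult power_abs mult_left_le_one_le
          intro!: mult_left_mono split: split_indicator)
  have F_summable: "summable (\<lambda>m. norm (F m t))" for t
    using F_le by (intro summable_comparison_test'[OF summable_mult2[OF c], of 0]) auto
  have int_summable: "summable (\<lambda>m. \<integral>t. norm (F m t) \<partial>M)"
  proof (rule summable_comparison_test'[where N = 0])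
    show "summable (\<lambda>m. norm (c m) * (\<integral>t. \<bar>indicator A t * w t\<bar> \<partial>M))"
      by (rule summable_mult2[OF c])
    fix m :: nat
    have "(\<integral>t. norm (F m t) \<partial>M) \<le> (\<integral>t. norm (c m) * \<bar>indicator A t * w t\<bar> \<partial>M)"
      by (intro integral_mono integrable_norm F_int integrable_mult_right wn F_le)
    then show "norm (\<integral>t. norm (F m t) \<partial>M) \<le> norm (c m) * (\<integral>t. \<bar>indicator A t * w t\<bar> \<partial>M)"
      by simp
  qed
  have sum_eq: "(\<Sum>m. F m t) =
      indicator A t *\<^sub>R ((\<Sum>m. c m * of_real (h t ^ m)) * of_real (w t))" for t
  proof (cases "t \<in> A")
    case True
    have "summable (\<lambda>m. c m * of_real (h t ^ m))"
      using pow_le[OF True]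
      by (intro summable_comparison_test'[OF c, of 0])
         (auto simp: norm_mult power_abs norm_power intro!: mult_left_le)
    then show ?thesis
      using True suminf_mult2[of "\<lambda>m. c m * of_real (h t ^ m)" "of_real (w t)"]
      by (simp add: F_def mult_ac)
  qed (simp add: F_def)
  have int_eq: "integral\<^sup>L M (F m) = c m * of_real (LINT t:A|M. h t ^ m * w t)" for m
    unfolding F_eq set_lebesgue_integral_def real_scaleR_def
    by (simp only: integral_mult_right_zero integral_complex_of_real)
  show "set_integrable M A (\<lambda>t. (\<Sum>m. c m * of_real (h t ^ m)) * of_real (w t))"
    using integrable_suminf[OF F_int _ int_summable] F_summable
    unfolding set_integrable_def sum_eq by auto
  show "(\<lambda>m. c m * of_real (LINT t:A|M. h t ^ m * w t)) sums
         (LINT t:A|M. (\<Sum>m. c m * of_real (h t ^ m)) * of_real (w t))"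
    using sums_integral[OF F_int _ int_summable] F_summable
    unfolding sum_eq int_eq by (simp only: set_lebesgue_integral_def) auto
qed

section \<open>Substitution and passage to the Lebesgue integral\<close>

text \<open>As \<open>g'\<close> is real, the integrand splits into real and imaginary parts of the
  same shape, and the real substitution rule applies to each.\<close>

lemma
  fixes f :: "real \<Rightarrow> complex" and g g' :: "real \<Rightarrow> real"
  assumes f: "set_integrable lborel {g a..g b} f"
    and g: "\<And>x. x \<in> {a..b} \<Longrightarrow> (g has_real_derivative g' x) (at x)"
           "continuous_on {a..b} g'" "\<And>x. x \<in> {a..b} \<Longrightarrow> g' x \<ge> 0" "a \<le> b"
  shows set_integrable_substitution_complex:
      "set_integrable lborel {a..b} (\<lambda>x. f (g x) * of_real (g' x))"
    and set_integral_substitution_complex: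
      "(LINT x:{a..b}|lborel. f (g x) * of_real (g' x)) = (LINT x:{g a..g b}|lborel. f x)"
proof -
  have re: "set_integrable lborel {g a..g b} (\<lambda>x. Re (f x))"
    and im: "set_integrable lborel {g a..g b} (\<lambda>x. Im (f x))"
    using integrable_Re[OF f[unfolded set_integrable_def]]
      integrable_Im[OF f[unfolded set_integrable_def]]
    by (simp_all add: set_integrable_def)
  note re' = integral_substitution[OF re g] and im' = integral_substitution[OF im g]
  have split: "indicator {a..b} x *\<^sub>R (f (g x) * of_real (g' x)) =
      of_real (indicator {a..b} x *\<^sub>R (Re (f (g x)) * g' x)) +
      \<i> * of_real (indicator {a..b} x *\<^sub>R (Im (f (g x)) * g' x))" for x
    by (auto simp: complex_eq_iff split: split_indicator)
  show int: "set_integrable lborel {a..b} (\<lambda>x. f (g x) * of_real (g' x))"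
    using re'(1) im'(1) unfolding set_integrable_def split
    by (intro Bochner_Integration.integrable_add integrable_mult_right integrable_of_real)
  show "(LINT x:{a..b}|lborel. f (g x) * of_real (g' x)) = (LINT x:{g a..g b}|lborel. f x)"
  proof (rule complex_eqI)
    show "Re (LINT x:{a..b}|lborel. f (g x) * of_real (g' x)) = Re (LINT x:{g a..g b}|lborel. f x)"
      using re'(2) integral_Re[OF f[unfolded set_integrable_def]]
        integral_Re[OF int[unfolded set_integrable_def]]
      by (simp add: set_lebesgue_integral_def mult_ac)
    show "Im (LINT x:{a..b}|lborel. f (g x) * of_real (g' x)) = Im (LINT x:{g a..g b}|lborel. f x)"
      using im'(2) integral_Im[OF f[unfolded set_integrable_def]]
        integral_Im[OF int[unfolded set_integrable_def]]
      by (simp add: set_lebesgue_integral_def mult_ac)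
  qed
qed

text \<open>For a nonnegative measurable function the gauge integral agrees with the
  \<open>nn_integral\<close>; being finite, it gives Lebesgue integrability. This transfers the Beta
  integral, whose integrand may be unbounded at 0.\<close>

lemma
  fixes f :: "real \<Rightarrow> real"
  assumes meas: "set_borel_measurable lborel A f" and nonneg: "\<And>x. x \<in> A \<Longrightarrow> f x \<ge> 0"
    and I: "(f has_integral I) A"
  shows set_integrable_of_has_integral_nonneg: "set_integrable lborel A f"
    and set_integral_of_has_integral_nonneg: "(LINT x:A|lborel. f x) = I"
proof -
  have "I \<ge> 0"
    using has_integral_nonneg[OF I nonneg] by auto
  moreover have "integral\<^sup>N lborel (\<lambda>x. indicator A x * f x) = I"
    using nonneg by (intro nn_integral_has_integral_lebesgue I) auto
  ultimately have "integrable lborel (\<lambda>x. indicator A x * f x) \<and>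
      integral\<^sup>L lborel (\<lambda>x. indicator A x * f x) = I"
    using meas nonneg unfolding set_borel_measurable_def
    by (subst (asm) nn_integral_eq_integrable) (auto split: split_indicator)
  then show "set_integrable lborel A f" "(LINT x:A|lborel. f x) = I"
    by (auto simp: set_integrable_def set_lebesgue_integral_def)
qed

section \<open>Beta and Wallis moments\<close>

text \<open>The value is B(\<alpha>, m + 1), where Gamma(m + 1) = m!. The factor
  \<open>fact m\<close> will cancel one of the two factorials in the coefficients of J_0.\<close>

lemma
  fixes \<alpha> :: real
  assumes "\<alpha> > 0"
  shows set_integrable_Beta_moment:
      "set_integrable lborel {0..1} (\<lambda>t. (1 - t) ^ m * t powr (\<alpha> - 1))"
    and set_integral_Beta_moment:
      "(LINT t:{0..1}|lborel. (1 - t) ^ m * t powr (\<alpha> - 1)) =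
         fact m * Gamma \<alpha> / Gamma (real m + \<alpha> + 1)"
proof -
  (* On the open interval, since 0 powr 0 = 0 disagrees with 0 ^ 0 = 1 at t = 1 for m = 0. *)
  have "((\<lambda>t. t powr (\<alpha> - 1) * (1 - t) powr (real (Suc m) - 1)) has_integral
      Beta \<alpha> (real (Suc m))) {0<..<1}"
    using has_integral_Beta_real[of \<alpha> "real (Suc m)"] assms by (simp add: has_integral_Icc_iff_Ioo)
  also have "?this \<longleftrightarrow> ((\<lambda>t. (1 - t) ^ m * t powr (\<alpha> - 1)) has_integral
      Beta \<alpha> (real (Suc m))) {0<..<1}"
    by (intro has_integral_cong) (auto simp: powr_realpow)
  finally have *: "((\<lambda>t. (1 - t) ^ m * t powr (\<alpha> - 1)) has_integral
      Beta \<alpha> (real (Suc m))) {0..1}"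
    by (simp add: has_integral_Icc_iff_Ioo)
  have meas: "set_borel_measurable lborel {0..1} (\<lambda>t::real. (1 - t) ^ m * t powr (\<alpha> - 1))"
    unfolding set_borel_measurable_def by measurable
  show "set_integrable lborel {0..1} (\<lambda>t. (1 - t) ^ m * t powr (\<alpha> - 1))"
    by (rule set_integrable_of_has_integral_nonneg[OF meas _ *]) auto
  have "Beta \<alpha> (real (Suc m)) = fact m * Gamma \<alpha> / Gamma (real m + \<alpha> + 1)"
    using Gamma_fact[of m, where 'a = real] by (simp add: Beta_def add_ac mult_ac)
  then show "(LINT t:{0..1}|lborel. (1 - t) ^ m * t powr (\<alpha> - 1)) =
         fact m * Gamma \<alpha> / Gamma (real m + \<alpha> + 1)"
    using set_integral_of_has_integral_nonneg[OF meas _ *] by auto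
qed

text \<open>Integrate the derivative of \<open>- cos x * sin x ^ (n + 1)\<close>, with the squared
  cosine replaced by one minus the squared sine. The boundary terms vanish because the exponent n +
  1 is positive and the sine is zero at 0 and at pi.\<close>

lemma Wallis_recursion:
  "real (n + 2) * (LINT x:{0..pi}|lborel. sin x ^ (n + 2)) =
     real (n + 1) * (LINT x:{0..pi}|lborel. sin x ^ n)"
proof -
  have int: "set_integrable lborel {0..pi} (\<lambda>x. k * sin x ^ j)" for j and k :: real
    by (intro borel_integrable_atLeastAtMost' continuous_intros)
  have deriv: "((\<lambda>x. - cos x * sin x ^ (n + 1)) has_vector_derivative
      real (n + 2) * sin x ^ (n + 2) - real (n + 1) * sin x ^ n) (at x within {0..pi})" for x :: real
  proof -
    have "((\<lambda>x. - cos x * sin x ^ (n + 1)) has_real_derivative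
        sin x * sin x ^ (n + 1) - (cos x)\<^sup>2 * (real (n + 1) * sin x ^ n)) (at x within {0..pi})"
      using DERIV_mult[OF DERIV_minus[OF DERIV_cos] DERIV_power_Suc[OF DERIV_sin, of n], of x]
      by (simp add: algebra_simps power2_eq_square has_field_derivative_at_within)
    moreover have "sin x * sin x ^ (n + 1) - (cos x)\<^sup>2 * (real (n + 1) * sin x ^ n) =
        real (n + 2) * sin x ^ (n + 2) - real (n + 1) * sin x ^ n"
      unfolding cos_squared_eq by (simp add: algebra_simps power2_eq_square)
    ultimately show ?thesis
      by (simp add: has_real_derivative_iff_has_vector_derivative)
  qed
  have "(LINT x:{0..pi}|lborel. real (n + 2) * sin x ^ (n + 2) - real (n + 1) * sin x ^ n) =
      - cos pi * sin pi ^ (n + 1) - - cos 0 * sin 0 ^ (n + 1)"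
    unfolding set_lebesgue_integral_def
    by (intro integral_FTC_atLeastAtMost deriv continuous_intros) auto
  then show ?thesis
    unfolding set_integral_diff(2)[OF int int] set_integral_mult_right by simp
qed

lemma Wallis_integral:
  "(LINT x:{0..pi}|lborel. sin x ^ (2 * n)) = pi * fact (2 * n) / (4 ^ n * (fact n)\<^sup>2)"
proof (induction n)
  case 0
  then show ?case by (simp add: set_lebesgue_integral_def)
next
  case (Suc n)
  have "(LINT x:{0..pi}|lborel. sin x ^ (2 * Suc n)) =
      real (2 * n + 1) / real (2 * n + 2) * (LINT x:{0..pi}|lborel. sin x ^ (2 * n))"
    using Wallis_recursion[of "2 * n"] by (simp add: field_simps)
  also have "\<dots> = pi * fact (2 * Suc n) / (4 ^ Suc n * (fact (Suc n))\<^sup>2)"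
    unfolding Suc.IH by (simp add: divide_simps power2_eq_square) (simp add: algebra_simps)
  finally show ?case .
qed

section \<open>Power series of J_0\<close>

text \<open>Comparison with the exponential series at \<open>norm z\<close>. It covers both the
  coefficients of J_0 and those coming from sine and cosine.\<close>

lemma summable_norm_power_div_fact:
  fixes c :: "nat \<Rightarrow> complex" and z :: complex
  assumes "\<And>m. norm (c m) \<le> K * norm z ^ m / fact m"
  shows "summable (\<lambda>m. norm (c m))"
proof (rule summable_comparison_test'[where N = 0])
  show "summable (\<lambda>m. K * (inverse (fact m) * norm z ^ m))"
    by (intro summable_mult summable_exp)
  show "norm (norm (c m)) \<le> K * (inverse (fact m) * norm z ^ m)" for m
    using assms[of m] by (simp add: divide_inverse mult_ac)
qed

text \<open>These are the coefficients of J_0(x s) as a power series in the square of s, which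
  separates the complex \<open>x\<close> from a real variable s.\<close>

definition Bessel_J0_coeff :: "complex \<Rightarrow> nat \<Rightarrow> complex" where
  "Bessel_J0_coeff x m = (-1) ^ m * (x / 2) ^ (2 * m) / (fact m)\<^sup>2"

lemma summable_norm_Bessel_J0_coeff: "summable (\<lambda>m. norm (Bessel_J0_coeff x m))"
proof (rule summable_norm_power_div_fact[where K = 1 and z = "(x / 2)\<^sup>2"])
  fix m :: nat
  have "norm (Bessel_J0_coeff x m) = norm ((x / 2)\<^sup>2) ^ m / (fact m)\<^sup>2"
    by (simp add: Bessel_J0_coeff_def norm_mult norm_divide norm_power power_mult)
  also have "\<dots> \<le> norm ((x / 2)\<^sup>2) ^ m / fact m"
    by (intro divide_left_mono) (auto simp: power2_eq_square)
  finally show "norm (Bessel_J0_coeff x m) \<le> 1 * norm ((x / 2)\<^sup>2) ^ m / fact m" by simp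
qed

text \<open>Only even powers of \<open>s\<close> occur, so s = sqrt(1 - t) will produce plain powers
  of 1 - t.\<close>

lemma Bessel_J0_mult_of_real:
  "Bessel_J 0 (x * of_real s) = (\<Sum>m. Bessel_J0_coeff x m * of_real ((s\<^sup>2) ^ m))"
proof -
  have "Gamma (real m + 1) = fact m" for m
    using Gamma_fact[of m, where 'a = real] by (simp add: add_ac)
  then show ?thesis
    by (simp add: Bessel_J_def principal_pow_def Bessel_J0_coeff_def power2_eq_square[of "fact _"]
          power_mult_distrib power_divide power_even_eq flip: power_mult)
       (simp add: mult_ac)
qed

section \<open>The single integral representation\<close>

lemma
  fixes \<alpha> :: real and x :: complex
  assumes "\<alpha> > 0"
  defines "f \<equiv> \<lambda>t::real. Bessel_J 0 (x * of_real (sqrt (1 - t))) * of_real (t powr (\<alpha> - 1))"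
  shows set_integrable_Bessel_J0_powr: "set_integrable lborel {0..1} f"
    and Bessel_J_eq_integral_Bessel_J0:
      "Bessel_J \<alpha> x = 1 / of_real (Gamma \<alpha>) * principal_pow (x / 2) \<alpha> * (LINT t:{0..1}|lborel. f t)"
proof -
  define F where "F = (\<lambda>t::real.
    (\<Sum>m. Bessel_J0_coeff x m * of_real ((1 - t) ^ m)) * of_real (t powr (\<alpha> - 1)))"
  \<comment> \<open>Restricted to the interval because the square of \<open>sqrt (1 - t)\<close> is
    \<open>1 - t\<close> only for t \<le> 1.\<close>
  have fF: "f t = F t" if "t \<in> {0..1}" for t
    using that unfolding f_def F_def Bessel_J0_mult_of_real by (simp only: atLeastAtMost_iff real_sqrt_pow2 diff_ge_0_iff_ge)
  have w: "set_integrable lborel {0..1} (\<lambda>t::real. t powr (\<alpha> - 1))"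
    using set_integrable_Beta_moment[OF assms(1), of 0] by simp
  have F: "set_integrable lborel {0..1} F"
    "(\<lambda>m. Bessel_J0_coeff x m * of_real (LINT t:{0..1}|lborel. (1 - t) ^ m * t powr (\<alpha> - 1)))
       sums (LINT t:{0..1}|lborel. F t)"
    unfolding F_def
    by (intro set_integrable_power_series_weight set_integral_power_series_weight_sums w
          summable_norm_Bessel_J0_coeff; auto)+
  show "set_integrable lborel {0..1} f"
    using F(1) set_integrable_cong[OF refl refl fF, of "{0..1}" "\<lambda>t. t" lborel] by simp
  have G: "Gamma \<alpha> \<noteq> 0"
    using Gamma_real_pos[OF assms(1)] by simp
  have f_int: "(LINT t:{0..1}|lborel. f t) = (LINT t:{0..1}|lborel. F t)"
    by (rule set_lebesgue_integral_cong) (auto simp: fF)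
  have "(\<lambda>m. 1 / of_real (Gamma \<alpha>) * principal_pow (x / 2) \<alpha> * (Bessel_J0_coeff x m *
      of_real (LINT t:{0..1}|lborel. (1 - t) ^ m * t powr (\<alpha> - 1)))) sums
      (1 / of_real (Gamma \<alpha>) * principal_pow (x / 2) \<alpha> * (LINT t:{0..1}|lborel. f t))"
    unfolding f_int by (intro sums_mult F(2))
  \<comment> \<open>\<open>Gamma \<alpha>\<close> from the Beta moment cancels the prefactor, and
    \<open>fact m\<close> reduces the squared factorial to a single one.\<close>
  also have "(\<lambda>m. 1 / of_real (Gamma \<alpha>) * principal_pow (x / 2) \<alpha> * (Bessel_J0_coeff x m *
      of_real (LINT t:{0..1}|lborel. (1 - t) ^ m * t powr (\<alpha> - 1)))) =
      (\<lambda>m. (-1) ^ m / (fact m * of_real (Gamma (real m + \<alpha> + 1)))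
           * ((x / 2) ^ (2 * m) * principal_pow (x / 2) \<alpha>))"
    using G unfolding set_integral_Beta_moment[OF assms(1)] Bessel_J0_coeff_def
    by (intro ext) (simp add: power2_eq_square)
  finally show "Bessel_J \<alpha> x =
      1 / of_real (Gamma \<alpha>) * principal_pow (x / 2) \<alpha> * (LINT t:{0..1}|lborel. f t)"
    unfolding Bessel_J_def by (simp add: sums_iff)
qed

section \<open>The inner integral over \<open>\<phi>\<close>\<close>

text \<open>With s = sin(phi), the integrand is s (sin(y s) + y s cos(y s)), which contains only the
  powers s^(2k+2). Its Wallis moments turn the coefficients into those of pi y J_0(y).\<close>

lemma
  fixes y :: complex
  defines "G \<equiv> \<lambda>\<phi>::real. of_real (sin \<phi>) * deriv (\<lambda>y. y * sin (y * of_real (sin \<phi>))) y"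
  shows set_integrable_sin_deriv: "set_integrable lborel {0..pi} G"
    and set_integral_sin_deriv: "(LINT \<phi>:{0..pi}|lborel. G \<phi>) = of_real pi * y * Bessel_J 0 y"
proof -
  \<comment> \<open>The reciprocal of (2k+1)! comes from the sine series, that of (2k)! from the
    cosine series.\<close>
  define e :: "nat \<Rightarrow> complex"
    where "e k = (-1) ^ k * y ^ (2 * k + 1) * (1 / fact (2 * k + 1) + 1 / fact (2 * k))" for k
  have e: "summable (\<lambda>k. norm (e k))"
  \<comment> \<open>Both reciprocal factorials are at most 1/k!, which gives the 2; the odd power of
    \<open>y\<close> leaves one extra \<open>norm y\<close>.\<close>
  proof (rule summable_norm_power_div_fact[where K = "2 * norm y" and z = "y\<^sup>2"])
    fix k :: nat
    have fact_le: "(1 / fact j :: real) \<le> 1 / fact k" if "k \<le> j" for j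
      using fact_mono[OF that, where 'a = real] by (intro divide_left_mono) auto
    then have "(1 / fact (2 * k + 1) + 1 / fact (2 * k) :: real) \<le> 1 / fact k + 1 / fact k"
      by (intro add_mono fact_le) auto
    moreover have "norm (1 / fact (2 * k + 1) + 1 / fact (2 * k) :: complex) \<le>
        1 / fact (2 * k + 1) + 1 / fact (2 * k)"
      by (rule order_trans[OF norm_triangle_ineq]) (simp add: norm_divide del: fact_Suc)
    ultimately have "norm (1 / fact (2 * k + 1) + 1 / fact (2 * k) :: complex) \<le> 2 / fact k"
      by simp
    then have "norm (y ^ (2 * k + 1)) * norm (1 / fact (2 * k + 1) + 1 / fact (2 * k) :: complex) \<le>
        norm (y ^ (2 * k + 1)) * (2 / fact k)"
      by (intro mult_left_mono norm_ge_zero)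
    then have "norm (e k) \<le> norm y ^ (2 * k + 1) * (2 / fact k)"
      by (simp add: e_def norm_mult norm_power del: fact_Suc)
    then show "norm (e k) \<le> 2 * norm y * norm (y\<^sup>2) ^ k / fact k"
      by (simp add: norm_power power_even_eq flip: power_mult) (simp add: mult_ac)
  qed
  have G_eq: "G \<phi> = (\<Sum>k. e k * of_real (((sin \<phi>)\<^sup>2) ^ k)) * of_real ((sin \<phi>)\<^sup>2)" for \<phi>
  proof -
    define s where "s = complex_of_real (sin \<phi>)"
    have "((\<lambda>y. y * sin (y * s)) has_field_derivative sin (y * s) + y * s * cos (y * s)) (at y)"
      by (auto intro!: derivative_eq_intros simp: algebra_simps)
    then have G1: "G \<phi> = s * (sin (y * s) + y * s * cos (y * s))"
      unfolding G_def s_def by (simp add: DERIV_imp_deriv)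
    have "(\<lambda>k. s * (((-1) ^ k / fact (2 * k + 1)) *\<^sub>R (y * s) ^ (2 * k + 1) +
        y * s * (((-1) ^ k / fact (2 * k)) *\<^sub>R (y * s) ^ (2 * k)))) sums G \<phi>"
      unfolding G1 by (intro sums_mult sums_add sin_series cos_series)
    also have "(\<lambda>k. s * (((-1) ^ k / fact (2 * k + 1)) *\<^sub>R (y * s) ^ (2 * k + 1) +
        y * s * (((-1) ^ k / fact (2 * k)) *\<^sub>R (y * s) ^ (2 * k)))) =
        (\<lambda>k. e k * (s\<^sup>2) ^ k * s\<^sup>2)"
    proof
      fix k
      have "s ^ (k * 2) = s ^ k * s ^ k"
        by (simp add: power_mult power2_eq_square)
      then show "s * (((-1) ^ k / fact (2 * k + 1)) *\<^sub>R (y * s) ^ (2 * k + 1) +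
          y * s * (((-1) ^ k / fact (2 * k)) *\<^sub>R (y * s) ^ (2 * k))) = e k * (s\<^sup>2) ^ k * s\<^sup>2"
        by (simp add: e_def scaleR_conv_of_real power2_eq_square[of s] algebra_simps del: fact_Suc)
    qed
    finally have *: "(\<lambda>k. e k * (s\<^sup>2) ^ k * s\<^sup>2) sums G \<phi>" .
    \<comment> \<open>Convergence without the factor \<open>s\<^sup>2\<close> is shown directly,
      since \<open>s\<close> may be zero and cannot be divided out.\<close>
    have "summable (\<lambda>k. e k * (s\<^sup>2) ^ k)"
    proof (rule summable_comparison_test'[OF e, of 0])
      have "norm s \<le> 1" by (simp add: s_def)
      then have "norm (s\<^sup>2) ^ k \<le> 1" for k by (simp add: norm_power power_le_one)
      then show "norm (e k * (s\<^sup>2) ^ k) \<le> norm (e k)" for k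
        by (auto simp: norm_mult norm_power intro!: mult_left_le)
    qed
    then have "(\<lambda>k. e k * (s\<^sup>2) ^ k * s\<^sup>2) sums ((\<Sum>k. e k * (s\<^sup>2) ^ k) * s\<^sup>2)"
      by (intro sums_mult2 summable_sums)
    with * show ?thesis
      by (simp add: sums_iff s_def)
  qed
  have w: "set_integrable lborel {0..pi} (\<lambda>\<phi>. (sin \<phi>)\<^sup>2)"
    by (intro borel_integrable_atLeastAtMost' continuous_intros)
  have sin_le: "\<bar>(sin \<phi>)\<^sup>2\<bar> \<le> 1" for \<phi> :: real
    by (simp add: abs_square_le_1)
  show "set_integrable lborel {0..pi} G"
    unfolding G_eq by (rule set_integrable_power_series_weight[OF _ _ sin_le w e]) auto
  have "(\<lambda>k. e k * of_real (LINT \<phi>:{0..pi}|lborel. ((sin \<phi>)\<^sup>2) ^ k * (sin \<phi>)\<^sup>2)) sums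
      (LINT \<phi>:{0..pi}|lborel. G \<phi>)"
    unfolding G_eq by (rule set_integral_power_series_weight_sums[OF _ _ sin_le w e]) auto
  moreover have "e k * of_real (LINT \<phi>:{0..pi}|lborel. ((sin \<phi>)\<^sup>2) ^ k * (sin \<phi>)\<^sup>2) =
      of_real pi * y * Bessel_J0_coeff y k" for k
  proof -
    have "(LINT \<phi>:{0..pi}|lborel. ((sin \<phi>)\<^sup>2) ^ k * (sin \<phi>)\<^sup>2) =
        pi * fact (2 * Suc k) / (4 ^ Suc k * (fact (Suc k))\<^sup>2)"
      unfolding Wallis_integral[symmetric] by (simp only: power_mult power_Suc2)
    moreover have "(1 + 2 * of_nat k :: complex) \<noteq> 0" "(1 + of_nat k :: complex) \<noteq> 0"
      using of_nat_eq_0_iff[of "1 + 2 * k", where 'a = complex]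
        of_nat_eq_0_iff[of "1 + k", where 'a = complex] by simp_all
    \<comment> \<open>The factorials and powers are abstracted to letters, leaving a rational
      identity: the two reciprocals add up to (2 + 2a)/((1 + 2a)F), and (2 + 2a)^2 cancels against
      4(1 + a)^2.\<close>
    moreover have "u * (Y * y) * (1 / ((1 + 2 * a) * F) + 1 / F) *
        (p * ((2 + 2 * a) * ((1 + 2 * a) * F)) / (4 * q * ((1 + a) * f)\<^sup>2)) =
        p * y * (u * (Y / q) / f\<^sup>2)"
      if "1 + 2 * a \<noteq> 0" "1 + a \<noteq> 0" "F \<noteq> 0" "q \<noteq> 0" "f \<noteq> 0" for u Y a F p q f :: complex
      using that by (simp add: divide_simps power2_eq_square) (simp add: algebra_simps)
    note this[of "of_nat k" "fact (2 * k)" "4 ^ k" "fact k" "(-1) ^ k" "y ^ (2 * k)" "of_real pi"]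
    moreover have "(y / 2) ^ (2 * k) = y ^ (2 * k) / 4 ^ k"
      by (simp add: power_divide power_mult)
    ultimately show ?thesis
      by (simp add: e_def Bessel_J0_coeff_def mult_ac)
  qed
  ultimately have "(\<lambda>k. of_real pi * y * Bessel_J0_coeff y k) sums (LINT \<phi>:{0..pi}|lborel. G \<phi>)"
    by simp
  moreover have "(\<lambda>k. of_real pi * y * Bessel_J0_coeff y k) sums (of_real pi * y * Bessel_J 0 y)"
    using Bessel_J0_mult_of_real[of y 1] summable_norm_cancel[OF summable_norm_Bessel_J0_coeff[of y]]
    by (intro sums_mult) (simp add: sums_iff)
  ultimately show "(LINT \<phi>:{0..pi}|lborel. G \<phi>) = of_real pi * y * Bessel_J 0 y"
    by (rule sums_unique2)
qed

section \<open>The double integral, by the substitution t = sin(theta)^2\<close>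

theorem mainTheorem1:
  fixes \<alpha> :: real and x :: complex
  assumes "\<alpha> > 0" and "x \<noteq> 0"
  defines "f \<equiv> \<lambda>t::real. Bessel_J 0 (x * complex_of_real (sqrt (1 - t)))
                              * complex_of_real (t powr (\<alpha> - 1))"
    and "g \<equiv> \<lambda>\<theta> \<phi>::real. 2 * complex_of_real (sin \<theta> powr (2 * \<alpha> - 1)) * complex_of_real (sin \<phi>)
               * deriv (\<lambda>y::complex. y * sin (y * complex_of_real (sin \<phi>)))
                       (x * complex_of_real (cos \<theta>))"
  shows "set_integrable lborel {0..1} f
    \<and> Bessel_J \<alpha> x = 1 / complex_of_real (Gamma \<alpha>) * principal_pow (x / 2) \<alpha>
                        * (LINT t:{0..1}|lborel. f t)
    \<and> (\<forall>\<theta>\<in>{0..pi/2}. set_integrable lborel {0..pi} (g \<theta>))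
    \<and> set_integrable lborel {0..pi/2} (\<lambda>\<theta>. LINT \<phi>:{0..pi}|lborel. g \<theta> \<phi>)
    \<and> Bessel_J \<alpha> x = 1 / (complex_of_real pi * x * complex_of_real (Gamma \<alpha>))
                        * principal_pow (x / 2) \<alpha>
                        * (LINT \<theta>:{0..pi/2}|lborel. (LINT \<phi>:{0..pi}|lborel. g \<theta> \<phi>))"
proof -
  have f: "set_integrable lborel {0..1} f"
    unfolding f_def by (rule set_integrable_Bessel_J0_powr[OF assms(1)])
  have J: "Bessel_J \<alpha> x = 1 / of_real (Gamma \<alpha>) * principal_pow (x / 2) \<alpha> *
      (LINT t:{0..1}|lborel. f t)"
    unfolding f_def by (rule Bessel_J_eq_integral_Bessel_J0[OF assms(1)])
  have g_eq: "g \<theta> = (\<lambda>\<phi>. 2 * of_real (sin \<theta> powr (2 * \<alpha> - 1)) * (of_real (sin \<phi>) *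
      deriv (\<lambda>y. y * sin (y * of_real (sin \<phi>))) (x * of_real (cos \<theta>))))" for \<theta>
    by (simp add: g_def mult_ac)
  have g: "set_integrable lborel {0..pi} (g \<theta>)" for \<theta>
    unfolding g_eq by (intro set_integrable_mult_right set_integrable_sin_deriv)
  let ?h = "\<lambda>\<theta>::real. (sin \<theta>)\<^sup>2" and ?h' = "\<lambda>\<theta>::real. 2 * sin \<theta> * cos \<theta>"
  \<comment> \<open>The factor cos(theta) in y = x cos(theta), together with one factor sin(theta)
    split off the power, forms the derivative of sin(theta)^2.\<close>
  have inner: "(LINT \<phi>:{0..pi}|lborel. g \<theta> \<phi>) = of_real pi * x * (f (?h \<theta>) * of_real (?h' \<theta>))"
    if \<theta>: "\<theta> \<in> {0..pi / 2}" for \<theta>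
  proof -
    have s: "sin \<theta> \<ge> 0" and c: "cos \<theta> \<ge> 0"
      using \<theta> by (auto intro!: sin_ge_zero cos_ge_zero)
    have root: "sqrt (1 - ?h \<theta>) = cos \<theta>"
      using c by (simp add: cos_squared_eq[symmetric])
    \<comment> \<open>For a nonzero sine the exponents add up as 2(\<alpha> - 1) + 1. For
      \<open>sin \<theta> = 0\<close> both sides are 0 whatever the exponent, as
      \<open>0 powr _\<close> is 0.\<close>
    have pow: "(?h \<theta>) powr (\<alpha> - 1) * sin \<theta> = sin \<theta> powr (2 * \<alpha> - 1)"
    proof (cases "sin \<theta> = 0")
      case False
      then have "(?h \<theta>) powr (\<alpha> - 1) = sin \<theta> powr (2 * \<alpha> - 2)"
        using s by (simp add: powr_powr algebra_simps flip: powr_numeral)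
      then show ?thesis
        using s powr_add[of "sin \<theta>" "2 * \<alpha> - 2" 1] by simp
    qed simp
    have f_subst: "f (?h \<theta>) * of_real (?h' \<theta>) = 2 * of_real ((?h \<theta>) powr (\<alpha> - 1) * sin \<theta>) *
        of_real (cos \<theta>) * Bessel_J 0 (x * of_real (cos \<theta>))"
      unfolding f_def root by (simp add: mult_ac)
    show ?thesis
      unfolding g_eq f_subst pow set_integral_mult_right set_integral_sin_deriv by (simp add: mult_ac)
  qed
  have f': "set_integrable lborel {?h 0..?h (pi / 2)} f"
    using f by simp
  have h_deriv: "(?h has_real_derivative ?h' \<theta>) (at \<theta>)" for \<theta>
    by (auto intro!: derivative_eq_intros)
  have h'_cont: "continuous_on {0..pi / 2} ?h'"
    by (intro continuous_intros)
  have h'_nonneg: "?h' \<theta> \<ge> 0" if "\<theta> \<in> {0..pi / 2}" for \<theta>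
    using that by (auto intro!: mult_nonneg_nonneg sin_ge_zero cos_ge_zero)
  have subst_int: "set_integrable lborel {0..pi / 2} (\<lambda>\<theta>. f (?h \<theta>) * of_real (?h' \<theta>))"
    using set_integrable_substitution_complex[OF f' h_deriv h'_cont h'_nonneg] by simp
  have subst_eq: "(LINT \<theta>:{0..pi / 2}|lborel. f (?h \<theta>) * of_real (?h' \<theta>)) =
      (LINT t:{0..1}|lborel. f t)"
    using set_integral_substitution_complex[OF f' h_deriv h'_cont h'_nonneg] by simp
  have outer: "set_integrable lborel {0..pi / 2} (\<lambda>\<theta>. LINT \<phi>:{0..pi}|lborel. g \<theta> \<phi>)"
    using set_integrable_mult_right[OF subst_int, of "of_real pi * x"] set_integrable_cong[OF refl refl inner, of "{0..pi / 2}" "\<lambda>\<theta>. \<theta>" lborel]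
    by simp
  have "(LINT \<theta>:{0..pi / 2}|lborel. (LINT \<phi>:{0..pi}|lborel. g \<theta> \<phi>)) =
      (LINT \<theta>:{0..pi / 2}|lborel. of_real pi * x * (f (?h \<theta>) * of_real (?h' \<theta>)))"
    by (rule set_lebesgue_integral_cong) (use inner in auto)
  also have "\<dots> = of_real pi * x * (LINT t:{0..1}|lborel. f t)"
    by (simp only: set_integral_mult_right subst_eq)
  \<comment> \<open>The factor pi x from the inner integral cancels against the prefactor, as
    \<open>x\<close> is nonzero.\<close>
  finally have "Bessel_J \<alpha> x = 1 / (of_real pi * x * of_real (Gamma \<alpha>)) *
      principal_pow (x / 2) \<alpha> * (LINT \<theta>:{0..pi / 2}|lborel. (LINT \<phi>:{0..pi}|lborel. g \<theta> \<phi>))"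
    using J assms(2) by simp
  with f J g outer show ?thesis by blast
qed

end
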